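(* Let $Q\subset\mathbb{C}^n$ be a complete circular domain centered at $0\in Q$, let $N\ge 1$ be an integer and $p\in(0,2]$. Let $R_{N,p}$ be the positive root of the equation $$2(1+r)r^N-p(1-r)^2=0$$ (the root lying in $(0,1)$). If $f$ is holomorphic in $Q$ with homogeneous expansion $f(z)=\sum_{k=0}^\infty P_k(z)$ converging in $Q$ and $|f(z)|<1$ for all $z\in Q$, then $$|f(z)|^p+\sum_{k=N}^{\infty}|P_k(z)|\le 1\quad\text{for all } z\in R_{N,p}\,Q.$$ Moreover, if $Q$ is convex, then the radius $R_{N,p}$ is best possible: for every $\rho\in(R_{N,p},1]$ there exist a holomorphic $f(z)=\sum_{k\ge0}P_k(z)$ on $Q$ with $|f|<1$ on $Q$ and a point $z\in\rho Q$ such that $|f(z)|^p+\sum_{k=N}^\infty|P_k(z)|>1$. In particular, $$R_{1,p}=\frac{p}{\sqrt{4p+1}+p+1}.$$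
   Context: A domain $Q\subset\mathbb{C}^n$ is a complete circular domain centered at $0\in Q$ if $\xi z=(\xi z_1,\ldots,\xi z_n)\in Q$ for every $z\in Q$ and every $\xi\in\mathbb{C}$ with $|\xi|\le 1$. Every holomorphic function $f$ on such a $Q$ has an expansion $f(z)=\sum_{k=0}^\infty P_k(z)$, $z\in Q$, where $P_k$ is a homogeneous polynomial of degree $k$ and $P_0=f(0)$. For $\rho>0$, the homothetic domain is $\rho Q=\{\rho z: z\in Q\}$.
   Formalization: The sharpness claim is stated for convex Q other than the whole space C^n; for Q = C^n it fails, since by Liouville every holomorphic f with |f|<1 is constant and the sum is |f|^p < 1. *)

theory Defs
  imports "HOL-Analysis.Analysis"
begin

definition complete_circular_domain :: "(complex ^ 'n) set \<Rightarrow> bool" where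
  "complete_circular_domain Q \<longleftrightarrow>
     open Q \<and> connected Q \<and> 0 \<in> Q \<and>
     (\<forall>z\<in>Q. \<forall>\<xi>::complex. cmod \<xi> \<le> 1 \<longrightarrow> \<xi> *s z \<in> Q)"

text \<open>
  Meant for open \<open>Q\<close>: the real Frechet derivative exists at every point and is
  complex-linear.
\<close>

definition holomorphic_several :: "(complex ^ 'n \<Rightarrow> complex) \<Rightarrow> (complex ^ 'n) set \<Rightarrow> bool"
    (infix "holomorphic'_several" 50) where
  "f holomorphic_several Q \<longleftrightarrow>
     (\<forall>z\<in>Q. \<exists>D. (f has_derivative D) (at z) \<and> (\<forall>c v. D (c *s v) = c * D v))"

text \<open>Homogeneous polynomials of degree \<open>k\<close>, including the zero polynomial; \<open>\<alpha>\<close> ranges over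
  the multi-indices of length \<open>k\<close>, of which there are finitely many.\<close>

definition homogeneous_polynomial :: "nat \<Rightarrow> (complex ^ 'n \<Rightarrow> complex) \<Rightarrow> bool" where
  "homogeneous_polynomial k P \<longleftrightarrow>
     (\<exists>c :: ('n \<Rightarrow> nat) \<Rightarrow> complex.
        \<forall>z. P z = (\<Sum>\<alpha> | (\<Sum>i\<in>UNIV. \<alpha> i) = k. c \<alpha> * (\<Prod>i\<in>UNIV. (z $ i) ^ \<alpha> i)))"

lemma finite_multiindices: "finite {\<alpha> :: 'n::finite \<Rightarrow> nat. (\<Sum>i\<in>UNIV. \<alpha> i) = k}"
proof (rule finite_subset)
  show "{\<alpha> :: 'n \<Rightarrow> nat. (\<Sum>i\<in>UNIV. \<alpha> i) = k} \<subseteq> (UNIV \<rightarrow>\<^sub>E {..k})"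
    by (auto simp: PiE_def Pi_def intro: member_le_sum)
qed (auto intro: finite_PiE)

definition homogeneous_expansion ::
    "(complex ^ 'n) set \<Rightarrow> (complex ^ 'n \<Rightarrow> complex) \<Rightarrow> (nat \<Rightarrow> complex ^ 'n \<Rightarrow> complex) \<Rightarrow> bool" where
  "homogeneous_expansion Q f P \<longleftrightarrow>
     (\<forall>k. homogeneous_polynomial k (P k)) \<and> (\<forall>z\<in>Q. (\<lambda>k. P k z) sums f z)"

definition radius_equation :: "nat \<Rightarrow> real \<Rightarrow> real \<Rightarrow> bool" where
  "radius_equation N p r \<longleftrightarrow> 2 * (1 + r) * r ^ N - p * (1 - r)\<^sup>2 = 0"

text \<open>For \<open>N \<ge> 1\<close> and \<open>0 < p \<le> 2\<close> the equation has exactly one positive root.\<close>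

definition bohr_radius :: "nat \<Rightarrow> real \<Rightarrow> real" where
  "bohr_radius N p = (THE r. 0 < r \<and> radius_equation N p r)"

end

theory Submission
  imports Defs "HOL-Complex_Analysis.Conformal_Mappings"
begin

text \<open>
  On a complete circular domain every point \<open>w\<close> spans a disc inside \<open>Q\<close>, and on that slice
  \<open>f (\<xi> w) = (\<Sum>k. P\<^sub>k(w) \<xi>\<^sup>k)\<close> is an ordinary power series bounded by one. The inequality is
  therefore a statement about one complex variable. Write \<open>a = \<bar>f 0\<bar>\<close>. Schwarz--Pick bounds the
  growth of the slice (\<open>schwarz_pick_growth\<close>) and, after averaging over roots of unity, yields
  Wiener's estimate \<open>\<bar>P\<^sub>k(w)\<bar> \<le> 1 - a\<^sup>2\<close> for every \<open>k \<ge> 1\<close> (\<open>bounded_powser_coeff\<close>). At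
  \<open>\<bar>\<xi>\<bar> = r\<close> the tail is then at most \<open>(1 - a\<^sup>2) r\<^sup>N / (1 - r)\<close>. As \<open>p \<le> 2\<close>, concavity of
  \<open>t \<mapsto> t powr (p / 2)\<close> gives \<open>\<bar>f\<bar> powr p \<le> 1 - p / 2 (1 - \<bar>f\<bar>\<^sup>2)\<close>, and Schwarz--Pick says
  that \<open>1 - \<bar>f\<bar>\<^sup>2 \<ge> (1 - a\<^sup>2) (1 - r) / (1 + r)\<close>. The factor \<open>1 - a\<^sup>2\<close> cancels, and what
  remains is \<open>r\<^sup>N / (1 - r) \<le> p / 2 (1 - r) / (1 + r)\<close>, which is an equality exactly at the
  radius (\<open>bohr_inequality_powser\<close>).

  For the Moebius maps \<open>(a + u) / (1 + a u)\<close> at \<open>u = r\<close> the growth bound is an equality, and the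
  losses in all other steps vanish to first order as \<open>a\<close> tends to \<open>1\<close>. For \<open>r\<close> beyond the radius
  these maps violate the inequality once \<open>a\<close> is close to \<open>1\<close> (\<open>moebius_exceeds_one\<close>). If \<open>Q\<close> is convex and proper, a supporting hyperplane
  gives a complex linear form that maps \<open>Q\<close> onto the open unit disc (see \<open>norming_linear_form\<close>),
  and composing the Moebius map with it transplants the counterexample to \<open>Q\<close>.
\<close>

section \<open>Power series bounded by one on the unit disc\<close>

text \<open>
  The exact deviation of the disc automorphism \<open>u \<mapsto> (a + u) / (1 + cnj a * u)\<close> from modulus one;
  in this division-free form it serves both for mapping the disc into itself and for inverting
  the automorphism in the Schwarz--Pick estimate.
\<close>

lemma moebius_norm_identity:
  fixes a u :: complex
  shows "(cmod (1 + cnj a * u))\<^sup>2 - (cmod (a + u))\<^sup>2 = (1 - (cmod a)\<^sup>2) * (1 - (cmod u)\<^sup>2)"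
  unfolding cmod_power2 by (simp add: algebra_simps power2_eq_square)

lemma moebius_denominator_nonzero:
  fixes a u :: complex
  assumes "cmod a < 1" "cmod u < 1"
  shows "1 + cnj a * u \<noteq> 0"
proof
  assume "1 + cnj a * u = 0"
  then have "cmod (cnj a * u) = 1"
    by (metis add_eq_0_iff2 norm_minus_cancel norm_one add.commute add_eq_0_iff)
  moreover have "cmod (cnj a * u) < 1 * 1"
    unfolding norm_mult using assms by (intro mult_strict_mono') auto
  ultimately show False by simp
qed

lemma moebius_norm_less_1:
  fixes a u :: complex
  assumes "cmod a < 1" "cmod u < 1"
  shows "cmod ((a + u) / (1 + cnj a * u)) < 1"
proof -
  have "0 < (1 - (cmod a)\<^sup>2) * (1 - (cmod u)\<^sup>2)"
    using assms by (simp add: abs_square_less_1)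
  then have "(cmod (a + u))\<^sup>2 < (cmod (1 + cnj a * u))\<^sup>2"
    using moebius_norm_identity[of a u] by linarith
  then have "cmod (a + u) < cmod (1 + cnj a * u)"
    by (rule power2_less_imp_less) simp
  then show ?thesis
    using moebius_denominator_nonzero[OF assms] by (simp add: norm_divide)
qed

text \<open>
  Both estimates are the Schwarz lemma for \<open>G\<close>, the composition of \<open>g\<close> with the disc automorphism
  that moves \<open>g 0\<close> to the origin. The growth estimate bounds \<open>1 - \<bar>g z\<bar>\<^sup>2\<close> from below
  since this is the quantity to which \<open>\<bar>g z\<bar> powr p\<close> is compared later.
\<close>

lemma schwarz_pick_at_0:
  fixes g :: "complex \<Rightarrow> complex"
  assumes hol: "g holomorphic_on ball 0 1"
    and bound: "\<And>z. cmod z < 1 \<Longrightarrow> cmod (g z) < 1"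
  shows schwarz_pick_growth: "\<And>z. cmod z < 1 \<Longrightarrow>
      (1 - (cmod (g 0))\<^sup>2) * (1 - (cmod z)\<^sup>2) \<le> (1 + cmod (g 0) * cmod z)\<^sup>2 * (1 - (cmod (g z))\<^sup>2)"
    and schwarz_pick_deriv: "cmod (deriv g 0) \<le> 1 - (cmod (g 0))\<^sup>2"
proof -
  define a where "a = g 0"
  have a: "cmod a < 1" using bound[of 0] by (simp add: a_def)
  define G where "G = (\<lambda>z. (- a + g z) / (1 + cnj (- a) * g z))"
  have nz: "1 + cnj (- a) * g z \<noteq> 0" if "cmod z < 1" for z
    using moebius_denominator_nonzero[of "- a" "g z"] a bound[OF that] by simp
  have G_hol: "G holomorphic_on ball 0 1"
    unfolding G_def using nz by (intro holomorphic_intros hol) auto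
  have G0: "G 0 = 0" by (simp add: G_def a_def)
  have G_bound: "cmod (G z) < 1" if "cmod z < 1" for z
    unfolding G_def using moebius_norm_less_1[of "- a" "g z"] a bound[OF that] by simp
  show "(1 - (cmod (g 0))\<^sup>2) * (1 - (cmod z)\<^sup>2) \<le> (1 + cmod (g 0) * cmod z)\<^sup>2 * (1 - (cmod (g z))\<^sup>2)"
    if z: "cmod z < 1" for z
  proof -
    have Gz: "cmod (G z) \<le> cmod z"
      using Schwarz_Lemma(1)[OF G_hol G0 G_bound z] by blast
    \<comment> \<open>Solving for \<open>g z\<close> shows that \<open>g z\<close> is the image of \<open>G z\<close> under the inverse
      automorphism, so the norm identity applies with \<open>u = G z\<close>.\<close>
    have "G z * (1 - cnj a * g z) = g z - a"
      using nz[OF z] by (simp add: G_def)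
    then have "a + G z = g z * (1 + cnj a * G z)"
      by (simp add: algebra_simps)
    then have "(cmod (a + G z))\<^sup>2 = (cmod (g z))\<^sup>2 * (cmod (1 + cnj a * G z))\<^sup>2"
      by (simp add: norm_mult power_mult_distrib)
    then have id: "(1 - (cmod a)\<^sup>2) * (1 - (cmod (G z))\<^sup>2) =
        (cmod (1 + cnj a * G z))\<^sup>2 * (1 - (cmod (g z))\<^sup>2)"
      using moebius_norm_identity[of a "G z"] by (simp add: algebra_simps)
    have "(1 - (cmod a)\<^sup>2) * (1 - (cmod z)\<^sup>2) \<le> (1 - (cmod a)\<^sup>2) * (1 - (cmod (G z))\<^sup>2)"
      using a Gz by (intro mult_left_mono) (auto simp: abs_square_le_1 power_mono)
    also have "\<dots> \<le> (1 + cmod a * cmod z)\<^sup>2 * (1 - (cmod (g z))\<^sup>2)"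
      unfolding id
    proof (intro mult_right_mono power_mono)
      have "cmod (1 + cnj a * G z) \<le> 1 + cmod a * cmod (G z)"
        by (metis complex_mod_cnj norm_mult norm_one norm_triangle_ineq)
      also have "\<dots> \<le> 1 + cmod a * cmod z"
        using Gz by (simp add: mult_left_mono)
      finally show "cmod (1 + cnj a * G z) \<le> 1 + cmod a * cmod z" .
      show "0 \<le> 1 - (cmod (g z))\<^sup>2"
        using bound[OF z] by (simp add: abs_square_le_1)
    qed simp
    finally show ?thesis by (simp add: a_def)
  qed
  show "cmod (deriv g 0) \<le> 1 - (cmod (g 0))\<^sup>2"
  proof -
    have dg: "(g has_field_derivative deriv g 0) (at 0)"
      using holomorphic_derivI[OF hol, of 0] by simp
    have aa: "1 - cnj a * a = of_real (1 - (cmod a)\<^sup>2)"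
      by (metis complex_norm_square mult.commute of_real_1 of_real_diff)
    have pos: "0 < 1 - (cmod a)\<^sup>2" using a by (simp add: abs_square_less_1)
    have nz0: "1 - cnj a * g 0 \<noteq> 0" using nz[of 0] by simp
    have "(G has_field_derivative deriv g 0 / (1 - cnj a * a)) (at 0)"
      unfolding G_def
      by (rule derivative_eq_intros dg refl)+ (use nz0 in \<open>simp_all add: a_def\<close>)
    then have "deriv G 0 = deriv g 0 / of_real (1 - (cmod a)\<^sup>2)"
      unfolding aa by (rule DERIV_imp_deriv)
    moreover have "cmod (deriv G 0) \<le> 1"
      using Schwarz_Lemma(2)[OF G_hol G0 G_bound, where \<xi> = 0] by simp
    ultimately have "cmod (deriv g 0) / (1 - (cmod a)\<^sup>2) \<le> 1"
      using pos by (simp add: norm_divide del: of_real_diff)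
    then show ?thesis using pos by (simp add: a_def)
  qed
qed

lemma powser_disc_deriv:
  fixes c :: "nat \<Rightarrow> complex"
  assumes "\<And>z. cmod z < 1 \<Longrightarrow> (\<lambda>n. c n * z ^ n) sums g z"
  shows "g holomorphic_on ball 0 1" and "g 0 = c 0" and "deriv g 0 = c 1"
proof -
  have der: "(g has_field_derivative (\<Sum>n. diffs c n * z ^ n)) (at z)" if "cmod z < 1" for z
  proof -
    have "((\<lambda>z. \<Sum>n. c n * z ^ n) has_field_derivative (\<Sum>n. diffs c n * z ^ n)) (at z)"
      using assms that by (intro termdiffs_strong'[where K = 1]) (auto simp: sums_iff)
    then show ?thesis
      by (rule has_field_derivative_transform_within_open[where S = "ball 0 1"])
        (use assms that in \<open>auto simp: sums_iff\<close>)
  qed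
  then show "g holomorphic_on ball 0 1"
    by (intro holomorphic_onI)
      (auto intro: has_field_derivative_at_within simp: field_differentiable_def)
  show "g 0 = c 0"
    using assms[of 0] by simp
  have "(\<lambda>n. diffs c n * 0 ^ n) sums diffs c 0" by (rule powser_sums_zero)
  then have "(\<Sum>n. diffs c n * 0 ^ n) = c 1"
    by (simp add: diffs_def sums_iff)
  then show "deriv g 0 = c 1"
    using DERIV_imp_deriv[OF der[of 0]] by simp
qed

text \<open>
  Orthogonality of characters, used to pick out the powers divisible by \<open>k\<close> from a power series.
\<close>

lemma sum_powers_root_of_unity:
  fixes k n :: nat
  assumes "0 < k"
  shows "(\<Sum>j<k. exp (2 * of_real pi * \<i> * of_nat j / of_nat k) ^ n :: complex)
       = (if k dvd n then of_nat k else 0)"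
proof -
  define w :: complex where "w = exp (2 * of_real pi * \<i> * of_nat n / of_nat k)"
  have swap: "exp (2 * of_real pi * \<i> * of_nat j / of_nat k) ^ n = w ^ j" for j
    unfolding w_def exp_of_nat_mult[symmetric] by (simp add: mult_ac)
  have w1: "w = 1 \<longleftrightarrow> k dvd n"
    unfolding w_def using complex_root_unity_eq_1[of k n] assms by simp
  have wk: "w ^ k = 1"
  proof -
    have "w ^ k = exp (2 * of_real pi * \<i> * of_nat n)"
      unfolding w_def exp_of_nat_mult[symmetric] using assms by simp
    also have "\<dots> = 1" using exp_integer_2pi[of "of_nat n"] by (simp add: mult_ac)
    finally show ?thesis .
  qed
  show ?thesis
  proof (cases "k dvd n")
    case True
    then show ?thesis unfolding swap using w1 by simp
  next
    case False
    then have "w \<noteq> 1" using w1 by simp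
    then show ?thesis unfolding swap using False wk by (simp add: geometric_sum)
  qed
qed

text \<open>
  Wiener's estimate. For \<open>k = 1\<close> it is the Schwarz--Pick bound for the derivative at the origin.
  In general, averaging \<open>g\<close> over the \<open>k\<close>-th roots of unity keeps the bound by one and leaves only
  the powers \<open>z ^ (k * m)\<close>; as a power series in \<open>y = z ^ k\<close> the average has constant
  coefficient \<open>c 0\<close> and linear coefficient \<open>c k\<close>.
\<close>

lemma bounded_powser_coeff:
  fixes c :: "nat \<Rightarrow> complex"
  assumes sums: "\<And>z. cmod z < 1 \<Longrightarrow> (\<lambda>n. c n * z ^ n) sums g z"
    and bound: "\<And>z. cmod z < 1 \<Longrightarrow> cmod (g z) < 1"
    and k: "0 < k"
  shows "cmod (c k) \<le> 1 - (cmod (c 0))\<^sup>2"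
proof -
  define \<omega> :: "nat \<Rightarrow> complex" where "\<omega> j = exp (2 * of_real pi * \<i> * of_nat j / of_nat k)" for j
  have norm_\<omega>: "cmod (\<omega> j) = 1" for j
    unfolding \<omega>_def by simp
  define h where "h z = (\<Sum>j<k. g (\<omega> j * z)) / of_nat k" for z
  have h_sums: "(\<lambda>m. c (k * m) * (z ^ k) ^ m) sums h z" if z: "cmod z < 1" for z
  proof -
    have "(\<lambda>n. (\<Sum>j<k. c n * (\<omega> j * z) ^ n) / of_nat k) sums h z"
      unfolding h_def using z norm_\<omega>
      by (intro sums_divide sums_sum sums) (simp add: norm_mult)
    moreover have "(\<Sum>j<k. c n * (\<omega> j * z) ^ n) / of_nat k = (if k dvd n then c n * z ^ n else 0)"
      for n
    proof -
      have "(\<Sum>j<k. c n * (\<omega> j * z) ^ n) = c n * z ^ n * (\<Sum>j<k. \<omega> j ^ n)"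
        by (simp add: sum_distrib_left power_mult_distrib mult_ac)
      then show ?thesis
        using k sum_powers_root_of_unity[OF k, of n] unfolding \<omega>_def by simp
    qed
    ultimately have "(\<lambda>n. if k dvd n then c n * z ^ n else 0) sums h z" by simp
    moreover have "strict_mono (\<lambda>m. k * m)" using k by (simp add: strict_mono_def)
    ultimately have "(\<lambda>m. if k dvd k * m then c (k * m) * z ^ (k * m) else 0) sums h z"
      by (subst sums_mono_reindex) (auto simp: dvd_def)
    then show ?thesis by (simp add: power_mult)
  qed
  have h_bound: "cmod (h z) < 1" if z: "cmod z < 1" for z
  proof -
    have "cmod (\<Sum>j<k. g (\<omega> j * z)) \<le> (\<Sum>j<k. cmod (g (\<omega> j * z)))" by (rule norm_sum)
    also have "\<dots> < (\<Sum>j<k. 1)"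
      using k z norm_\<omega> by (intro sum_strict_mono bound) (auto simp: norm_mult)
    finally show ?thesis using k by (simp add: h_def norm_divide)
  qed
  define H where "H y = (\<Sum>m. c (k * m) * y ^ m)" for y
  have root: "\<exists>z. cmod z < 1 \<and> z ^ k = y" if "cmod y < 1" for y :: complex
  proof -
    obtain z where z: "z ^ k = y"
      using exists_complex_root[of k y] k by auto
    have "cmod z < 1"
    proof (rule ccontr)
      assume "\<not> cmod z < 1"
      then have "1 \<le> cmod z ^ k" by (simp add: one_le_power)
      then show False using that z by (metis norm_power not_le)
    qed
    then show ?thesis using z by blast
  qed
  have H_sums: "(\<lambda>m. c (k * m) * y ^ m) sums H y" and H_bound: "cmod (H y) < 1"
    if "cmod y < 1" for y
    using root[OF that] h_sums h_bound by (auto simp: H_def sums_iff)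
  note H = powser_disc_deriv[of "\<lambda>m. c (k * m)" H, OF H_sums]
  show ?thesis
    using schwarz_pick_deriv[OF H(1) H_bound] H(2,3) by simp
qed


section \<open>The radius equation\<close>

lemma radius_function_strict_mono:
  assumes "0 < p" "0 \<le> x" "x < y" "y \<le> 1"
  shows "2 * (1 + x) * x ^ N - p * (1 - x)\<^sup>2 < 2 * (1 + y) * y ^ N - p * (1 - y :: real)\<^sup>2"
proof -
  have "2 * (1 + x) * x ^ N \<le> 2 * (1 + y) * y ^ N"
    using assms by (intro mult_mono power_mono) auto
  moreover have "(1 - y)\<^sup>2 < (1 - x)\<^sup>2"
    using assms by (intro power_strict_mono) auto
  ultimately show ?thesis using assms by (smt (verit) mult_strict_left_mono)
qed

lemma radius_root:
  assumes "1 \<le> N" "0 < p" "p \<le> 2"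
  shows ex1_radius: "\<exists>!r. 0 < r \<and> radius_equation N p r"
    and bohr_radius_less_1: "bohr_radius N p < 1"
proof -
  define F :: "real \<Rightarrow> real" where "F r = 2 * (1 + r) * r ^ N - p * (1 - r)\<^sup>2" for r
  have F0: "F 0 < 0" using assms by (simp add: F_def power_0_left)
  have F1: "F 1 > 0" by (simp add: F_def)
  have "\<exists>r\<ge>0. r \<le> 1 \<and> F r = 0"
    using F0 F1 unfolding F_def by (intro IVT') (auto intro!: continuous_intros)
  then obtain r where r: "0 \<le> r" "r \<le> 1" "F r = 0" by blast
  with F0 F1 have r01: "0 < r" "r < 1" by (auto simp: less_le)
  have uniq: "s = r" if s: "0 < s" "F s = 0" for s
  proof -
    have "s \<le> 1"
    proof (rule ccontr)
      assume "\<not> s \<le> 1"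
      then have s1: "1 < s" by simp
      \<comment> \<open>The term \<open>p * (1 - s)\<^sup>2\<close> grows again beyond \<open>1\<close>, so monotonicity says nothing there;
        instead \<open>F\<close> is positive, because \<open>2 (1 - s)\<^sup>2 < 2 (1 + s) s\<close> and \<open>p \<le> 2\<close>.\<close>
      then have "s ^ 1 \<le> s ^ N" using assms by (intro power_increasing) auto
      then have "2 * (1 + s) * s \<le> 2 * (1 + s) * s ^ N" using s1 by simp
      moreover have "p * (1 - s)\<^sup>2 \<le> 2 * (1 - s)\<^sup>2" using assms by (simp add: mult_right_mono)
      moreover have "2 * (1 - s)\<^sup>2 < 2 * (1 + s) * s"
        using s1 by (simp add: power2_eq_square algebra_simps)
      ultimately show False using s unfolding F_def by linarith
    qed
    then show ?thesis
      using radius_function_strict_mono[of p s r N] radius_function_strict_mono[of p r s N] r s assms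
      unfolding F_def by linarith
  qed
  have F_iff: "radius_equation N p s \<longleftrightarrow> F s = 0" for s
    by (simp add: radius_equation_def F_def)
  show ex1: "\<exists>!r. 0 < r \<and> radius_equation N p r"
    unfolding F_iff using r01(1) r(3) uniq by blast
  show "bohr_radius N p < 1"
    unfolding bohr_radius_def using theI'[OF ex1] uniq r01(2) by (metis F_iff)
qed

lemma bohr_radius_root:
  assumes "1 \<le> N" "0 < p" "p \<le> 2"
  shows "0 < bohr_radius N p" and "radius_equation N p (bohr_radius N p)"
proof -
  have "0 < bohr_radius N p \<and> radius_equation N p (bohr_radius N p)"
    unfolding bohr_radius_def by (rule theI'[OF ex1_radius[OF assms]])
  then show "0 < bohr_radius N p" and "radius_equation N p (bohr_radius N p)" by simp_all
qed

lemma bohr_radius_eqI: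
  assumes "1 \<le> N" "0 < p" "p \<le> 2" "0 < r" "radius_equation N p r"
  shows "bohr_radius N p = r"
  unfolding bohr_radius_def
  by (rule the1_equality[OF ex1_radius[OF assms(1-3)] conjI[OF assms(4,5)]])

lemma bohr_radius_1:
  assumes "0 < p" "p \<le> 2"
  shows "bohr_radius 1 p = p / (sqrt (4 * p + 1) + p + 1)"
proof (rule bohr_radius_eqI)
  define s where "s = sqrt (4 * p + 1)"
  have s: "0 \<le> s" "s\<^sup>2 = 4 * p + 1" using assms by (auto simp: s_def)
  define d where "d = s + p + 1"
  have d: "0 < d" using s assms by (simp add: d_def)
  have "2 * (d + p) * p - p * (d - p)\<^sup>2 = p * (4 * p + 1 - s\<^sup>2)"
    unfolding d_def by (simp add: power2_eq_square algebra_simps)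
  \<comment> \<open>Clearing denominators in the quadratic equation leaves exactly the equation that
    defines the square root.\<close>
  then have "2 * (d + p) * p = p * (d - p)\<^sup>2" using s by simp
  then have "2 * (1 + p / d) * (p / d) = p * (1 - p / d)\<^sup>2"
    using d by (simp add: field_simps power2_eq_square)
  then show "radius_equation 1 p (p / (sqrt (4 * p + 1) + p + 1))"
    by (simp add: radius_equation_def d_def s_def)
  show "0 < p / (sqrt (4 * p + 1) + p + 1)"
    using d assms by (simp add: d_def s_def)
qed (use assms in auto)

section \<open>The inequality and its sharpness in one variable\<close>

text \<open>
  The graph of the concave function \<open>t \<mapsto> t powr (p / 2)\<close> lies below its tangent at \<open>t = 1\<close>; here
  \<open>t = x\<^sup>2\<close>.
\<close>

lemma powr_le_quadratic:
  fixes x p :: real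
  assumes "0 \<le> x" "0 < p" "p \<le> 2"
  shows "x powr p \<le> 1 - p / 2 * (1 - x\<^sup>2)"
proof (cases "x = 0")
  case False
  then have x: "0 < x" using assms by simp
  have "(x\<^sup>2) powr (p / 2) * 1 powr (1 - p / 2) \<le> p / 2 * x\<^sup>2 + (1 - p / 2) * 1"
    using assms x by (intro Youngs_inequality_0) auto
  moreover have "(x\<^sup>2) powr (p / 2) = x powr p"
    using x by (simp add: powr_powr flip: powr_numeral)
  ultimately show ?thesis by (simp add: algebra_simps)
qed (use assms in auto)

text \<open>
  The gain \<open>1 - \<bar>g r\<bar> powr p\<close> and the tail are both compared with
  \<open>p / 2 * (1 - a\<^sup>2) * (1 - r) / (1 + r)\<close>: the first by Schwarz--Pick growth, the second by
  Wiener's estimate, a geometric series and the condition on \<open>r\<close>. The common factor \<open>1 - a\<^sup>2\<close>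
  is what makes the condition independent of \<open>a\<close>.
\<close>

lemma bohr_inequality_powser:
  fixes c :: "nat \<Rightarrow> complex"
  assumes sums: "\<And>z. cmod z < 1 \<Longrightarrow> (\<lambda>n. c n * z ^ n) sums g z"
    and bound: "\<And>z. cmod z < 1 \<Longrightarrow> cmod (g z) < 1"
    and "1 \<le> N" "0 < p" "p \<le> 2" and r: "0 \<le> r" "r < 1"
    and radius: "2 * (1 + r) * r ^ N \<le> p * (1 - r)\<^sup>2"
  shows "summable (\<lambda>k. cmod (c (N + k) * of_real r ^ (N + k)))"
    and "cmod (g (of_real r)) powr p + (\<Sum>k. cmod (c (N + k) * of_real r ^ (N + k))) \<le> 1"
proof -
  define a where "a = cmod (c 0)"
  define A where "A = cmod (g (of_real r))"
  note g = powser_disc_deriv[of c g, OF sums]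
  have a: "0 \<le> a" "a < 1" using bound[of 0] g(2) by (auto simp: a_def)
  then have a2: "0 < 1 - a\<^sup>2" by (simp add: abs_square_less_1)
  have coeff_le: "cmod (c (N + k) * of_real r ^ (N + k)) \<le> (1 - a\<^sup>2) * r ^ N * r ^ k" for k
    using bounded_powser_coeff[of c g "N + k", OF sums bound] r \<open>1 \<le> N\<close>
    by (simp add: a_def norm_mult norm_power power_add mult.assoc mult_right_mono)
  have geo: "(\<lambda>k. (1 - a\<^sup>2) * r ^ N * r ^ k) sums ((1 - a\<^sup>2) * r ^ N * (1 / (1 - r)))"
    using r by (intro sums_mult geometric_sums) simp
  show summ: "summable (\<lambda>k. cmod (c (N + k) * of_real r ^ (N + k)))"
    using coeff_le by (intro summable_comparison_test'[OF sums_summable[OF geo]]) simp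
  have "(\<Sum>k. cmod (c (N + k) * of_real r ^ (N + k))) \<le> (\<Sum>k. (1 - a\<^sup>2) * r ^ N * r ^ k)"
    by (intro suminf_le coeff_le summ sums_summable[OF geo])
  also have "\<dots> = (1 - a\<^sup>2) * (r ^ N / (1 - r))"
    using sums_unique[OF geo] by simp
  also have "\<dots> \<le> (1 - a\<^sup>2) * (p / 2 * ((1 - r) / (1 + r)))"
    using radius r a2
    by (intro mult_left_mono) (simp_all add: field_simps power2_eq_square)
  finally have tail: "(\<Sum>k. cmod (c (N + k) * of_real r ^ (N + k)))
      \<le> p / 2 * ((1 - a\<^sup>2) * ((1 - r) / (1 + r)))" by (simp add: mult_ac)
  have A: "A < 1" "0 \<le> A" using bound[of "of_real r"] r by (auto simp: A_def)
  then have A2: "0 \<le> 1 - A\<^sup>2" by (simp add: abs_square_le_1)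
  have "(1 - a\<^sup>2) * (1 - r\<^sup>2) \<le> (1 + a * r)\<^sup>2 * (1 - A\<^sup>2)"
    using schwarz_pick_growth[of g "of_real r", OF g(1) bound] r g(2) by (simp add: a_def A_def)
  also have "\<dots> \<le> (1 + r)\<^sup>2 * (1 - A\<^sup>2)"
    using a r A2 by (intro mult_right_mono power_mono) (auto simp: mult_left_le_one_le)
  finally have "(1 + r) * ((1 - a\<^sup>2) * (1 - r)) \<le> (1 + r) * ((1 + r) * (1 - A\<^sup>2))"
    by (simp add: power2_eq_square algebra_simps)
  then have "(1 - a\<^sup>2) * (1 - r) \<le> (1 + r) * (1 - A\<^sup>2)" using r by simp
  then have "(1 - a\<^sup>2) * ((1 - r) / (1 + r)) \<le> 1 - A\<^sup>2"
    using r by (simp add: field_simps)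
  then have "p / 2 * ((1 - a\<^sup>2) * ((1 - r) / (1 + r))) \<le> p / 2 * (1 - A\<^sup>2)"
    using \<open>0 < p\<close> by (intro mult_left_mono) auto
  then show "cmod (g (of_real r)) powr p + (\<Sum>k. cmod (c (N + k) * of_real r ^ (N + k))) \<le> 1"
    using tail powr_le_quadratic[OF A(2) \<open>0 < p\<close> \<open>p \<le> 2\<close>] unfolding A_def by linarith
qed

text \<open>The Taylor coefficients of \<open>(a + u) / (1 + a * u)\<close> at \<open>u = 0\<close>.\<close>

definition moebius_coeff :: "real \<Rightarrow> nat \<Rightarrow> complex" where
  "moebius_coeff a k = (if k = 0 then of_real a else of_real ((1 - a\<^sup>2) * (- a) ^ (k - 1)))"

lemma moebius_coeff_sums:
  assumes "0 \<le> a" "a < 1" "cmod u < 1"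
  shows "(\<lambda>k. moebius_coeff a k * u ^ k) sums ((of_real a + u) / (1 + of_real a * u))"
proof -
  have nz: "1 + of_real a * u \<noteq> 0"
    using moebius_denominator_nonzero[of "of_real a" u] assms by simp
  have "cmod (- of_real a * u) < 1"
    using assms mult_strict_mono'[of a 1 "cmod u" 1] by (simp add: norm_mult)
  then have "(\<lambda>k. of_real (1 - a\<^sup>2) * u * (- of_real a * u) ^ k) sums
      (of_real (1 - a\<^sup>2) * u * (1 / (1 - (- of_real a * u))))"
    by (intro sums_mult geometric_sums)
  moreover have "moebius_coeff a (Suc k) * u ^ Suc k = of_real (1 - a\<^sup>2) * u * (- of_real a * u) ^ k" for k
    unfolding power_mult_distrib by (simp add: moebius_coeff_def mult_ac)
  ultimately have "(\<lambda>k. moebius_coeff a (Suc k) * u ^ Suc k) sums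
      (of_real (1 - a\<^sup>2) * u * (1 / (1 - (- of_real a * u))))" by (simp only:)
  from sums_Suc[OF this] have "(\<lambda>k. moebius_coeff a k * u ^ k) sums
      (of_real (1 - a\<^sup>2) * u / (1 + of_real a * u) + moebius_coeff a 0 * u ^ 0)"
    by simp
  moreover have "of_real (1 - a\<^sup>2) * u / (1 + of_real a * u) + moebius_coeff a 0 * u ^ 0
      = (of_real a + u) / (1 + of_real a * u)"
    using nz by (simp add: moebius_coeff_def field_simps power2_eq_square)
  ultimately show ?thesis by simp
qed

lemma moebius_coeff_tail_sums:
  assumes "0 \<le> a" "a < 1" "0 \<le> r" "r < 1" "1 \<le> N"
  shows "(\<lambda>k. cmod (moebius_coeff a (N + k) * of_real r ^ (N + k))) sums
      ((1 - a\<^sup>2) * (a ^ (N - 1) * r ^ N / (1 - a * r)))"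
proof -
  have "a * r < 1" using assms mult_strict_mono'[of a 1 r 1] by simp
  then have "(\<lambda>k. (1 - a\<^sup>2) * a ^ (N - 1) * r ^ N * (a * r) ^ k) sums
      ((1 - a\<^sup>2) * a ^ (N - 1) * r ^ N * (1 / (1 - a * r)))"
    using assms by (intro sums_mult geometric_sums) simp
  moreover have "cmod (moebius_coeff a (N + k) * of_real r ^ (N + k)) =
      (1 - a\<^sup>2) * a ^ (N - 1) * r ^ N * (a * r) ^ k" for k
  proof -
    obtain M where M: "N = Suc M" using assms by (cases N) auto
    have "0 \<le> 1 - a\<^sup>2" using assms by (simp add: abs_square_le_1)
    then have "cmod (moebius_coeff a (N + k)) = (1 - a\<^sup>2) * a ^ (M + k)"
      unfolding moebius_coeff_def M using assms
      by (simp add: abs_mult power_abs del: of_real_mult of_real_diff of_real_power of_real_minus)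
    then show ?thesis using assms
      by (simp add: M norm_mult norm_power power_add power_mult_distrib mult_ac)
  qed
  ultimately show ?thesis by (simp add: mult.assoc)
qed

text \<open>
  At \<open>a = 1\<close> the left-hand side of the Bohr inequality for the Moebius map equals \<open>1\<close>, and its
  derivative in \<open>a\<close> is \<open>p * (1 - r) / (1 + r) - 2 * r ^ N / (1 - r)\<close>. Beyond the radius this
  is negative, so the value exceeds \<open>1\<close> for \<open>a\<close> slightly smaller than \<open>1\<close>.
\<close>

lemma moebius_exceeds_one:
  fixes p r :: real
  assumes "0 < r" "r < 1" and radius: "p * (1 - r)\<^sup>2 < 2 * (1 + r) * r ^ N"
  shows "\<exists>a. 0 < a \<and> a < 1 \<and>
    1 < ((a + r) / (1 + a * r)) powr p + (1 - a\<^sup>2) * (a ^ (N - 1) * r ^ N / (1 - a * r))"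
proof -
  define D where "D a = ((a + r) / (1 + a * r)) powr p + (1 - a\<^sup>2) * (a ^ (N - 1) * r ^ N / (1 - a * r))" for a
  have r1: "1 + r \<noteq> 0" "1 - r \<noteq> 0" using assms by auto
  have dA: "((\<lambda>a. (a + r) / (1 + a * r)) has_field_derivative (1 - r) / (1 + r)) (at 1)"
  proof -
    have "((\<lambda>a. (a + r) / (1 + a * r)) has_field_derivative
        (1 * (1 + 1 * r) - (1 + r) * r) / ((1 + 1 * r) * (1 + 1 * r))) (at 1)"
      using r1 by (auto intro!: derivative_eq_intros)
    moreover have "(1 * (1 + 1 * r) - (1 + r) * r) / ((1 + 1 * r) * (1 + 1 * r)) = (1 - r) / (1 + r)"
    proof -
      have "1 * (1 + 1 * r) - (1 + r) * r = (1 + r) * (1 - r)" by (simp add: algebra_simps)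
      then show ?thesis using r1 by simp
    qed
    ultimately show ?thesis by simp
  qed
  have dA': "((\<lambda>a. ((a + r) / (1 + a * r)) powr p) has_field_derivative p * ((1 - r) / (1 + r))) (at 1)"
    by (rule DERIV_cong[OF DERIV_fun_powr[OF dA]]) (use r1 in \<open>simp_all add: add.commute\<close>)
  have dS: "((\<lambda>a. 1 - a\<^sup>2) has_field_derivative - 2) (at (1::real))"
    by (auto intro!: derivative_eq_intros)
  \<comment> \<open>In the product rule the derivative of this factor is multiplied by \<open>1 - a\<^sup>2\<close>, which
    vanishes at \<open>a = 1\<close>, so its existence is enough.\<close>
  have "(\<lambda>a. a ^ (N - 1) * r ^ N / (1 - a * r)) differentiable (at 1)"
    using r1 by (intro derivative_intros) auto
  then obtain B where dB: "((\<lambda>a. a ^ (N - 1) * r ^ N / (1 - a * r)) has_field_derivative B) (at 1)"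
    by (auto simp: real_differentiable_def)
  have dD: "(D has_field_derivative p * ((1 - r) / (1 + r)) - 2 * (r ^ N / (1 - r))) (at 1)"
    unfolding D_def by (rule DERIV_cong[OF DERIV_add[OF dA' DERIV_mult[OF dS dB]]]) simp
  have neg: "p * ((1 - r) / (1 + r)) - 2 * (r ^ N / (1 - r)) < 0"
  proof -
    have "p * (1 - r)\<^sup>2 / ((1 - r) * (1 + r)) < 2 * (1 + r) * r ^ N / ((1 - r) * (1 + r))"
      using assms by (intro divide_strict_right_mono radius) auto
    moreover have "2 * (1 + r) * r ^ N / ((1 - r) * (1 + r)) = 2 * (r ^ N / (1 - r))"
      using r1 by (simp add: divide_simps)
    ultimately show ?thesis using r1 by (simp add: power2_eq_square)
  qed
  obtain d where d: "d > 0" "\<And>h. 0 < h \<Longrightarrow> h < d \<Longrightarrow> D 1 < D (1 - h)"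
    using DERIV_neg_dec_left[OF dD neg] by blast
  define h where "h = min (d / 2) (1 / 2)"
  have h: "0 < h" "h < d" "h < 1" using d by (auto simp: h_def)
  have "D 1 = 1" using r1 by (simp add: D_def add.commute)
  then show ?thesis
    using d(2)[OF h(1,2)] h by (intro exI[of _ "1 - h"]) (auto simp: D_def)
qed

section \<open>Homogeneous polynomials and linear forms\<close>

lemma homogeneous_polynomial_scale:
  assumes "homogeneous_polynomial k P"
  shows "P (x *s z) = x ^ k * P z"
proof -
  obtain c where c: "P z = (\<Sum>\<alpha> | (\<Sum>i\<in>UNIV. \<alpha> i) = k. c \<alpha> * (\<Prod>i\<in>UNIV. (z $ i) ^ \<alpha> i))" for z
    using assms unfolding homogeneous_polynomial_def by blast
  have "(\<Prod>i\<in>UNIV. ((x *s z) $ i) ^ \<alpha> i) = x ^ k * (\<Prod>i\<in>UNIV. (z $ i) ^ \<alpha> i)"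
    if "(\<Sum>i\<in>UNIV. \<alpha> i) = k" for \<alpha>
    using that by (simp add: power_mult_distrib prod.distrib flip: power_sum)
  then show ?thesis unfolding c by (simp add: sum_distrib_left mult_ac)
qed

lemma homogeneous_polynomial_const: "homogeneous_polynomial 0 (\<lambda>z :: complex ^ 'n. b)"
proof -
  have "{\<alpha> :: 'n \<Rightarrow> nat. (\<Sum>i\<in>UNIV. \<alpha> i) = 0} = {\<lambda>_. 0}" by auto
  then show ?thesis unfolding homogeneous_polynomial_def by (intro exI[of _ "\<lambda>_. b"]) simp
qed

lemma homogeneous_polynomial_cmult:
  assumes "homogeneous_polynomial k P"
  shows "homogeneous_polynomial k (\<lambda>z. b * P z)"
proof -
  obtain c where "\<forall>z. P z = (\<Sum>\<alpha> | (\<Sum>i\<in>UNIV. \<alpha> i) = k. c \<alpha> * (\<Prod>i\<in>UNIV. (z $ i) ^ \<alpha> i))"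
    using assms unfolding homogeneous_polynomial_def by blast
  then show ?thesis unfolding homogeneous_polynomial_def
    by (intro exI[of _ "\<lambda>\<alpha>. b * c \<alpha>"]) (simp add: sum_distrib_left mult.assoc)
qed

lemma homogeneous_polynomial_add:
  assumes "homogeneous_polynomial k P" "homogeneous_polynomial k R"
  shows "homogeneous_polynomial k (\<lambda>z. P z + R z)"
proof -
  obtain c where "\<forall>z. P z = (\<Sum>\<alpha> | (\<Sum>i\<in>UNIV. \<alpha> i) = k. c \<alpha> * (\<Prod>i\<in>UNIV. (z $ i) ^ \<alpha> i))"
    using assms(1) unfolding homogeneous_polynomial_def by blast
  moreover obtain d where "\<forall>z. R z = (\<Sum>\<alpha> | (\<Sum>i\<in>UNIV. \<alpha> i) = k. d \<alpha> * (\<Prod>i\<in>UNIV. (z $ i) ^ \<alpha> i))"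
    using assms(2) unfolding homogeneous_polynomial_def by blast
  ultimately show ?thesis unfolding homogeneous_polynomial_def
    by (intro exI[of _ "\<lambda>\<alpha>. c \<alpha> + d \<alpha>"]) (simp add: sum.distrib algebra_simps)
qed

lemma homogeneous_polynomial_sum:
  assumes "finite I" "\<And>i. i \<in> I \<Longrightarrow> homogeneous_polynomial k (P i)"
  shows "homogeneous_polynomial k (\<lambda>z. \<Sum>i\<in>I. P i z)"
  using assms
proof (induction I rule: finite_induct)
  case empty
  show ?case unfolding homogeneous_polynomial_def by (intro exI[of _ "\<lambda>_. 0"]) simp
qed (simp add: homogeneous_polynomial_add)

text \<open>
  Multiplication by a coordinate shifts multi-indices by one unit vector. The shift is a
  bijection onto the multi-indices that are positive at \<open>i\<close>; the others receive the
  coefficient zero.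
\<close>

lemma homogeneous_polynomial_coord_mult:
  fixes P :: "complex ^ 'n \<Rightarrow> complex"
  assumes "homogeneous_polynomial k P"
  shows "homogeneous_polynomial (Suc k) (\<lambda>z. z $ i * P z)"
proof -
  obtain c where c: "\<And>z. P z = (\<Sum>\<alpha> | (\<Sum>i\<in>UNIV. \<alpha> i) = k. c \<alpha> * (\<Prod>i\<in>UNIV. (z $ i) ^ \<alpha> i))"
    using assms unfolding homogeneous_polynomial_def by blast
  define up :: "('n \<Rightarrow> nat) \<Rightarrow> ('n \<Rightarrow> nat)" where "up \<alpha> = \<alpha>(i := Suc (\<alpha> i))" for \<alpha>
  define down :: "('n \<Rightarrow> nat) \<Rightarrow> ('n \<Rightarrow> nat)" where "down \<alpha> = \<alpha>(i := \<alpha> i - 1)" for \<alpha>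
  have split_sum: "(\<Sum>j\<in>UNIV. \<alpha> j) = \<alpha> i + (\<Sum>j\<in>UNIV - {i}. \<alpha> j)" for \<alpha> :: "'n \<Rightarrow> nat"
    by (simp add: sum.remove)
  have sum_up: "(\<Sum>j\<in>UNIV. up \<alpha> j) = Suc (\<Sum>j\<in>UNIV. \<alpha> j)" for \<alpha>
    unfolding split_sum[of "up \<alpha>"] split_sum[of \<alpha>] by (simp add: up_def)
  have prod_up: "(\<Prod>j\<in>UNIV. (z $ j) ^ up \<alpha> j) = z $ i * (\<Prod>j\<in>UNIV. (z $ j) ^ \<alpha> j)"
    for \<alpha> and z :: "complex ^ 'n"
    by (simp add: prod.remove[of UNIV i] up_def mult.assoc)
  have up_down: "up (down \<alpha>) = \<alpha>" if "\<alpha> i \<noteq> 0" for \<alpha>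
    using that by (simp add: up_def down_def fun_eq_iff)
  have down_up: "down (up \<alpha>) = \<alpha>" for \<alpha>
    by (simp add: up_def down_def fun_eq_iff)
  have "z $ i * P z = (\<Sum>\<beta> | (\<Sum>j\<in>UNIV. \<beta> j) = Suc k.
      (if \<beta> i = 0 then 0 else c (down \<beta>)) * (\<Prod>j\<in>UNIV. (z $ j) ^ \<beta> j))" for z
  proof -
    have "z $ i * P z = (\<Sum>\<alpha> | (\<Sum>j\<in>UNIV. \<alpha> j) = k. c \<alpha> * (\<Prod>j\<in>UNIV. (z $ j) ^ up \<alpha> j))"
      unfolding c prod_up by (simp add: sum_distrib_left mult_ac)
    also have "\<dots> = (\<Sum>\<beta> | (\<Sum>j\<in>UNIV. \<beta> j) = Suc k \<and> \<beta> i \<noteq> 0.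
        c (down \<beta>) * (\<Prod>j\<in>UNIV. (z $ j) ^ \<beta> j))"
    proof (rule sum.reindex_bij_witness[of _ down up])
      fix \<beta> :: "'n \<Rightarrow> nat" assume \<beta>: "\<beta> \<in> {\<beta>. (\<Sum>j\<in>UNIV. \<beta> j) = Suc k \<and> \<beta> i \<noteq> 0}"
      then show "up (down \<beta>) = \<beta>" by (simp add: up_down)
      then show "down \<beta> \<in> {\<alpha>. (\<Sum>j\<in>UNIV. \<alpha> j) = k}" using sum_up[of "down \<beta>"] \<beta> by simp
    qed (simp_all add: down_up sum_up, simp add: up_def)
    also have "\<dots> = (\<Sum>\<beta> | (\<Sum>j\<in>UNIV. \<beta> j) = Suc k.
        (if \<beta> i = 0 then 0 else c (down \<beta>)) * (\<Prod>j\<in>UNIV. (z $ j) ^ \<beta> j))"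
      by (rule sum.mono_neutral_cong_left) (auto simp: finite_multiindices)
    finally show ?thesis .
  qed
  then show ?thesis unfolding homogeneous_polynomial_def
    by (intro exI[of _ "\<lambda>\<beta>. if \<beta> i = 0 then 0 else c (down \<beta>)"]) simp
qed

definition linear_form :: "complex ^ 'n \<Rightarrow> complex ^ 'n \<Rightarrow> complex" where
  "linear_form l z = (\<Sum>i\<in>UNIV. l $ i * z $ i)"

lemma linear_form_scale: "linear_form l (c *s z) = c * linear_form l z"
  by (simp add: linear_form_def sum_distrib_left mult_ac)

lemma linear_form_scale_left: "linear_form (c *s l) z = c * linear_form l z"
  by (simp add: linear_form_def sum_distrib_left mult_ac)

lemma scaleR_eq_scalar_mult: "r *\<^sub>R z = (of_real r :: complex) *s z"
  unfolding vec_eq_iff vector_scaleR_component vector_smult_component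
  by (simp add: scaleR_conv_of_real)

lemma bounded_linear_linear_form: "bounded_linear (linear_form l)"
  unfolding linear_form_def[abs_def]
  by (intro bounded_linear_sum bounded_linear_mult_const bounded_linear_const_mult bounded_linear_vec_nth)

lemma homogeneous_polynomial_linear_form_power:
  "homogeneous_polynomial k (\<lambda>z. linear_form l z ^ k)"
proof (induction k)
  case 0
  show ?case using homogeneous_polynomial_const[of 1] by simp
next
  case (Suc k)
  have "homogeneous_polynomial (Suc k) (\<lambda>z. \<Sum>i\<in>UNIV. l $ i * (z $ i * linear_form l z ^ k))"
    by (intro homogeneous_polynomial_sum homogeneous_polynomial_cmult
        homogeneous_polynomial_coord_mult Suc.IH) simp
  then show ?case by (simp add: linear_form_def sum_distrib_right mult.assoc)
qed

text \<open>
  A real hyperplane separating \<open>Q\<close> from an outside point is the real part of a complex linear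
  form. Rotating its argument, which a circular domain allows, turns the bound on the real part
  into a bound on the modulus, and the form is then divided by its supremum \<open>M\<close> over \<open>Q\<close>. Openness
  of \<open>Q\<close> keeps the supremum from being attained; circularity lets the form take every value below it.
\<close>

lemma norming_linear_form:
  fixes Q :: "(complex ^ 'n) set"
  assumes Q: "complete_circular_domain Q" and "convex Q" and "Q \<noteq> UNIV"
  obtains l where "\<And>z. z \<in> Q \<Longrightarrow> cmod (linear_form l z) < 1"
    and "\<And>t. 0 \<le> t \<Longrightarrow> t < 1 \<Longrightarrow> \<exists>z\<in>Q. linear_form l z = of_real t"
proof -
  have op: "open Q" and zero: "0 \<in> Q"
    and circ: "\<And>z \<xi>. z \<in> Q \<Longrightarrow> cmod \<xi> \<le> 1 \<Longrightarrow> \<xi> *s z \<in> Q"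
    using Q by (auto simp: complete_circular_domain_def)
  obtain w where w: "w \<notin> Q" using \<open>Q \<noteq> UNIV\<close> by auto
  obtain u b where u: "u \<noteq> 0" "\<And>z. z \<in> Q \<Longrightarrow> u \<bullet> z \<le> b"
    using separating_hyperplane_sets[of Q "{w}"] \<open>convex Q\<close> zero w by auto
  define m where "m = (\<chi> i. cnj (u $ i))"
  have Re_m: "Re (linear_form m z) = u \<bullet> z" for z
    by (simp add: linear_form_def m_def inner_vec_def inner_complex_def)
  have rotate: "\<exists>\<xi>. cmod \<xi> = 1 \<and> \<xi> * y = of_real (cmod y)" for y :: complex
  proof (cases "y = 0")
    case False
    then show ?thesis
      by (intro exI[of _ "of_real (cmod y) / y"]) (simp add: norm_divide)
  qed (auto intro: exI[of _ 1])
  have m_le: "cmod (linear_form m z) \<le> b" if z: "z \<in> Q" for z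
  proof -
    obtain \<xi> where \<xi>: "cmod \<xi> = 1" "\<xi> * linear_form m z = of_real (cmod (linear_form m z))"
      using rotate by blast
    have "Re (linear_form m (\<xi> *s z)) \<le> b"
      unfolding Re_m using circ[OF z] \<xi>(1) u(2) by simp
    then show ?thesis by (simp add: linear_form_scale \<xi>(2))
  qed
  define M where "M = (SUP z\<in>Q. cmod (linear_form m z))"
  have bdd: "bdd_above ((\<lambda>z. cmod (linear_form m z)) ` Q)"
    by (rule bdd_aboveI2[OF m_le])
  have M_upper: "cmod (linear_form m z) \<le> M" if "z \<in> Q" for z
    unfolding M_def by (rule cSUP_upper[OF that bdd])
  have grow: "\<exists>e>0. (1 + e) *\<^sub>R z \<in> Q" if z: "z \<in> Q" for z
  proof -
    have "((\<lambda>e. (1 + e) *\<^sub>R z) \<longlongrightarrow> (1 + 0) *\<^sub>R z) (at_right (0::real))"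
      by (intro tendsto_intros)
    then have "eventually (\<lambda>e. (1 + e) *\<^sub>R z \<in> Q) (at_right (0::real))"
      using op z by (intro topological_tendstoD) auto
    then have "eventually (\<lambda>e. 0 < e \<and> (1 + e) *\<^sub>R z \<in> Q) (at_right (0::real))"
      using eventually_at_right_less[of "0::real"] by eventually_elim auto
    then show ?thesis using eventually_happens'[OF trivial_limit_at_right_real] by blast
  qed
  have M_pos: "0 < M"
  proof -
    have "((\<lambda>e. e *\<^sub>R u) \<longlongrightarrow> 0 *\<^sub>R u) (at_right (0::real))"
      by (intro tendsto_intros)
    then have "eventually (\<lambda>e. e *\<^sub>R u \<in> Q) (at_right (0::real))"
      using op zero by (intro topological_tendstoD) auto
    then have "eventually (\<lambda>e. 0 < e \<and> e *\<^sub>R u \<in> Q) (at_right (0::real))"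
      using eventually_at_right_less[of "0::real"] by eventually_elim auto
    then obtain e :: real where e: "0 < e" "e *\<^sub>R u \<in> Q"
      using eventually_happens'[OF trivial_limit_at_right_real] by blast
    have "0 < u \<bullet> (e *\<^sub>R u)" using e u by simp
    also have "\<dots> \<le> cmod (linear_form m (e *\<^sub>R u))"
      unfolding Re_m[symmetric] by (rule complex_Re_le_cmod)
    also have "\<dots> \<le> M" by (rule M_upper[OF e(2)])
    finally show ?thesis .
  qed
  have M_strict: "cmod (linear_form m z) < M" if z: "z \<in> Q" for z
  proof (cases "linear_form m z = 0")
    case False
    obtain e where e: "e > 0" "(1 + e) *\<^sub>R z \<in> Q" using grow[OF z] by blast
    have "cmod (linear_form m z) < (1 + e) * cmod (linear_form m z)"
      using False e by simp
    also have "\<dots> = cmod (linear_form m ((1 + e) *\<^sub>R z))"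
      unfolding scaleR_eq_scalar_mult linear_form_scale norm_mult norm_of_real using e by simp
    also have "\<dots> \<le> M" by (rule M_upper[OF e(2)])
    finally show ?thesis .
  qed (use M_pos in simp)
  define l where "l = of_real (1 / M) *s m"
  have l: "linear_form l z = linear_form m z / of_real M" for z
    by (simp add: l_def linear_form_scale_left)
  show ?thesis
  proof (rule that[of l])
    show "cmod (linear_form l z) < 1" if "z \<in> Q" for z
      using M_strict[OF that] M_pos by (simp add: l norm_divide)
    show "\<exists>z\<in>Q. linear_form l z = of_real t" if t: "0 \<le> t" "t < 1" for t
    proof -
      have "t * M < M" using t M_pos by simp
      then obtain v where v: "v \<in> Q" "t * M < cmod (linear_form m v)"
        using less_cSUP_iff[OF _ bdd, of "t * M"] zero unfolding M_def[symmetric] by auto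
      have "linear_form m v \<noteq> 0" using v(2) t M_pos
        by (auto simp: mult_less_0_iff)
      define \<xi> where "\<xi> = of_real (t * M) / linear_form m v"
      have "cmod \<xi> \<le> 1" using v t M_pos by (simp add: \<xi>_def norm_divide norm_mult divide_le_eq)
      moreover have "linear_form l (\<xi> *s v) = of_real t"
        using \<open>linear_form m v \<noteq> 0\<close> M_pos by (simp add: l linear_form_scale \<xi>_def)
      ultimately show ?thesis using circ[OF v(1)] by blast
    qed
  qed
qed

section \<open>Transfer to circular domains\<close>

text \<open>
  By homogeneity \<open>P k (\<xi> *s w) = P k w * \<xi> ^ k\<close>, so the expansion restricted to the disc spanned
  by \<open>w\<close> is a power series bounded by one. Its convergence makes the restriction holomorphic, so
  the one-variable inequality applies.
\<close>

lemma bohr_inequality_circular: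
  fixes Q :: "(complex ^ 'n) set"
  assumes Q: "complete_circular_domain Q" and "1 \<le> N" "0 < p" "p \<le> 2"
    and exp: "homogeneous_expansion Q f P" and bound: "\<And>z. z \<in> Q \<Longrightarrow> cmod (f z) < 1"
    and r: "0 \<le> r" "r < 1" "2 * (1 + r) * r ^ N \<le> p * (1 - r)\<^sup>2" and w: "w \<in> Q"
  shows "summable (\<lambda>k. cmod (P (N + k) (r *\<^sub>R w)))"
    and "cmod (f (r *\<^sub>R w)) powr p + (\<Sum>k. cmod (P (N + k) (r *\<^sub>R w))) \<le> 1"
proof -
  have P_scale: "P k (\<xi> *s w) = P k w * \<xi> ^ k" for k \<xi>
    using homogeneous_polynomial_scale[of k "P k" \<xi> w] exp
    by (simp add: homogeneous_expansion_def mult.commute)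
  have slice: "\<xi> *s w \<in> Q" if "cmod \<xi> < 1" for \<xi>
    using Q w that by (auto simp: complete_circular_domain_def)
  have sums: "(\<lambda>k. P k w * \<xi> ^ k) sums f (\<xi> *s w)" if "cmod \<xi> < 1" for \<xi>
    using exp slice[OF that] by (simp add: homogeneous_expansion_def flip: P_scale)
  note B = bohr_inequality_powser[of "\<lambda>k. P k w" "\<lambda>\<xi>. f (\<xi> *s w)", OF sums bound[OF slice] assms(2-4) r]
  show "summable (\<lambda>k. cmod (P (N + k) (r *\<^sub>R w)))"
    and "cmod (f (r *\<^sub>R w)) powr p + (\<Sum>k. cmod (P (N + k) (r *\<^sub>R w))) \<le> 1"
    using B by (simp_all add: scaleR_eq_scalar_mult P_scale)
qed

lemma holomorphic_several_compose_linear_form: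
  assumes "\<And>z. z \<in> Q \<Longrightarrow> h field_differentiable at (linear_form l z)"
  shows "(\<lambda>z. h (linear_form l z)) holomorphic_several Q"
  unfolding holomorphic_several_def
proof
  fix z assume "z \<in> Q"
  then obtain h' where h': "(h has_field_derivative h') (at (linear_form l z))"
    using assms by (auto simp: field_differentiable_def)
  have "((\<lambda>z. h (linear_form l z)) has_derivative (\<lambda>v. h' * linear_form l v)) (at z)"
    using h' unfolding has_field_derivative_def
    by (rule has_derivative_compose[OF bounded_linear_imp_has_derivative[OF bounded_linear_linear_form]])
  then show "\<exists>D. ((\<lambda>z. h (linear_form l z)) has_derivative D) (at z) \<and> (\<forall>c v. D (c *s v) = c * D v)"
    by (intro exI[of _ "\<lambda>v. h' * linear_form l v"]) (simp add: linear_form_scale)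
qed

text \<open>
  The extremal function is a Moebius map of the norming form. The intermediate radius \<open>r\<close> between
  the Bohr radius and \<open>\<rho>\<close> leaves room for a point \<open>w\<close> of \<open>Q\<close> at which the form takes the value
  \<open>r / \<rho>\<close>, since the value \<open>1\<close> is not attained on \<open>Q\<close>.
\<close>

lemma bohr_radius_sharp:
  fixes Q :: "(complex ^ 'n) set"
  assumes Q: "complete_circular_domain Q" "convex Q" "Q \<noteq> UNIV"
    and Np: "1 \<le> N" "0 < p" "p \<le> 2" and \<rho>: "bohr_radius N p < \<rho>" "\<rho> \<le> 1"
  shows "\<exists>f P. f holomorphic_several Q \<and> homogeneous_expansion Q f P \<and> (\<forall>z\<in>Q. cmod (f z) < 1) \<and>
    (\<exists>z \<in> (\<lambda>w. \<rho> *\<^sub>R w) ` Q. summable (\<lambda>k. cmod (P (N + k) z)) \<and>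
       cmod (f z) powr p + (\<Sum>k. cmod (P (N + k) z)) > 1)"
proof -
  obtain l where l_less: "\<And>z. z \<in> Q \<Longrightarrow> cmod (linear_form l z) < 1"
    and l_onto: "\<And>t. 0 \<le> t \<Longrightarrow> t < 1 \<Longrightarrow> \<exists>z\<in>Q. linear_form l z = of_real t"
    using norming_linear_form[OF Q] by metis
  obtain r where r: "bohr_radius N p < r" "r < \<rho>" using dense \<rho>(1) by blast
  have R: "0 < bohr_radius N p" "radius_equation N p (bohr_radius N p)"
    using bohr_radius_root[OF Np] by auto
  have r01: "0 < r" "r < 1" using r R \<rho> by auto
  have "p * (1 - r)\<^sup>2 < 2 * (1 + r) * r ^ N"
    using radius_function_strict_mono[of p "bohr_radius N p" r N] R r r01 Np
    by (simp add: radius_equation_def)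
  then obtain a where a: "0 < a" "a < 1"
    and exceeds: "1 < ((a + r) / (1 + a * r)) powr p + (1 - a\<^sup>2) * (a ^ (N - 1) * r ^ N / (1 - a * r))"
    using moebius_exceeds_one[OF r01] by blast
  define h :: "complex \<Rightarrow> complex" where "h u = (of_real a + u) / (1 + of_real a * u)" for u
  define f where "f z = h (linear_form l z)" for z
  define P where "P k z = moebius_coeff a k * linear_form l z ^ k" for k z
  have "h field_differentiable at u" if "cmod u < 1" for u
    unfolding h_def using moebius_denominator_nonzero[of "of_real a" u] a that
    by (intro derivative_intros) auto
  then have "f holomorphic_several Q"
    unfolding f_def using l_less by (intro holomorphic_several_compose_linear_form) auto
  moreover have "homogeneous_expansion Q f P"
    unfolding homogeneous_expansion_def P_def f_def h_def
    using a l_less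
    by (auto intro!: homogeneous_polynomial_cmult homogeneous_polynomial_linear_form_power
        moebius_coeff_sums)
  moreover have "\<forall>z\<in>Q. cmod (f z) < 1"
    unfolding f_def h_def using a l_less moebius_norm_less_1[of "of_real a"] by simp
  moreover
  obtain w where w: "w \<in> Q" "linear_form l w = of_real (r / \<rho>)"
    using l_onto[of "r / \<rho>"] r01 r by auto
  have lz: "linear_form l (\<rho> *\<^sub>R w) = of_real r"
    using w r01 r by (simp add: scaleR_eq_scalar_mult linear_form_scale)
  have "cmod (f (\<rho> *\<^sub>R w)) = (a + r) / (1 + a * r)"
  proof -
    have "f (\<rho> *\<^sub>R w) = of_real ((a + r) / (1 + a * r))" by (simp add: f_def h_def lz)
    then show ?thesis using a r01 by (simp only: norm_of_real) simp
  qed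
  moreover have "(\<lambda>k. cmod (P (N + k) (\<rho> *\<^sub>R w))) sums
      ((1 - a\<^sup>2) * (a ^ (N - 1) * r ^ N / (1 - a * r)))"
    unfolding P_def lz using a r01 Np by (intro moebius_coeff_tail_sums) auto
  ultimately show ?thesis
    using exceeds w(1) by (intro exI[of _ f] exI[of _ P]) (auto simp: sums_iff)
qed

theorem theorem4:
  fixes Q :: "(complex ^ 'n) set" and N :: nat and p :: real
  assumes "complete_circular_domain Q" and "N \<ge> 1" and "0 < p" and "p \<le> 2"
  shows
    "(\<exists>!r. 0 < r \<and> radius_equation N p r) \<and>
     0 < bohr_radius N p \<and> bohr_radius N p < 1 \<and> radius_equation N p (bohr_radius N p) \<and>
     (\<forall>f P. f holomorphic_several Q \<longrightarrow> homogeneous_expansion Q f P \<longrightarrow> (\<forall>z\<in>Q. cmod (f z) < 1) \<longrightarrow>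
        (\<forall>z \<in> (\<lambda>w. bohr_radius N p *\<^sub>R w) ` Q.
           summable (\<lambda>k. cmod (P (N + k) z)) \<and>
           cmod (f z) powr p + (\<Sum>k. cmod (P (N + k) z)) \<le> 1)) \<and>
     (convex Q \<longrightarrow> Q \<noteq> UNIV \<longrightarrow>
        (\<forall>\<rho>. bohr_radius N p < \<rho> \<longrightarrow> \<rho> \<le> 1 \<longrightarrow>
           (\<exists>f P. f holomorphic_several Q \<and> homogeneous_expansion Q f P \<and> (\<forall>z\<in>Q. cmod (f z) < 1) \<and>
              (\<exists>z \<in> (\<lambda>w. \<rho> *\<^sub>R w) ` Q.
                 summable (\<lambda>k. cmod (P (N + k) z)) \<and>
                 cmod (f z) powr p + (\<Sum>k. cmod (P (N + k) z)) > 1)))) \<and>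
     bohr_radius 1 p = p / (sqrt (4 * p + 1) + p + 1)"
proof (intro conjI allI impI ballI)
  note Np = \<open>N \<ge> 1\<close> \<open>0 < p\<close> \<open>p \<le> 2\<close>
  show "\<exists>!r. 0 < r \<and> radius_equation N p r" by (rule ex1_radius[OF Np])
  show R: "0 < bohr_radius N p" "bohr_radius N p < 1" "radius_equation N p (bohr_radius N p)"
    using bohr_radius_root[OF Np] bohr_radius_less_1[OF Np] by auto
  show "bohr_radius 1 p = p / (sqrt (4 * p + 1) + p + 1)" by (rule bohr_radius_1[OF Np(2,3)])
  fix f P z
  assume exp: "homogeneous_expansion Q f P" and bound: "\<forall>z\<in>Q. cmod (f z) < 1"
    and "z \<in> (\<lambda>w. bohr_radius N p *\<^sub>R w) ` Q"
  then obtain w where w: "w \<in> Q" "z = bohr_radius N p *\<^sub>R w" by blast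
  have r: "0 \<le> bohr_radius N p" "bohr_radius N p < 1"
    "2 * (1 + bohr_radius N p) * bohr_radius N p ^ N \<le> p * (1 - bohr_radius N p)\<^sup>2"
    using R by (auto simp: radius_equation_def)
  note B = bohr_inequality_circular[OF assms(1) Np exp _ r w(1)]
  show "summable (\<lambda>k. cmod (P (N + k) z))"
    and "cmod (f z) powr p + (\<Sum>k. cmod (P (N + k) z)) \<le> 1"
    unfolding w(2) using B bound by auto
next
  fix \<rho> assume "convex Q" "Q \<noteq> UNIV" "bohr_radius N p < \<rho>" "\<rho> \<le> 1"
  then show "\<exists>f P. f holomorphic_several Q \<and> homogeneous_expansion Q f P \<and> (\<forall>z\<in>Q. cmod (f z) < 1) \<and>
      (\<exists>z \<in> (\<lambda>w. \<rho> *\<^sub>R w) ` Q.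
         summable (\<lambda>k. cmod (P (N + k) z)) \<and>
         cmod (f z) powr p + (\<Sum>k. cmod (P (N + k) z)) > 1)"
    by (rule bohr_radius_sharp[OF assms(1) _ _ assms(2-4)])
qed

end
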